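(* Let $X$ be an Archimedean vector lattice. Relative uniform convergence $\mathrm{ru}$ on $X$ is first countable. Furthermore, the following statements are equivalent: (i) there exists a countable set $C\subseteq X_+$ such that $X=I_C$; (ii) $\mathrm{ru}$ is strongly first countable. If either (i) or (ii), and hence both, is true, then the unbounded modification $\mathrm{uru}$ of $\mathrm{ru}$ is strongly first countable.
   Context: Nets are indexed by pre-ordered upward directed sets. A tail of $(x_\alpha)$ is a set $\{x_\alpha:\alpha\ge\alpha_0\}$. A net $(y_\beta)$ is a quasi-subnet of $(x_\alpha)$ if every tail of $(x_\alpha)$ contains a tail of $(y_\beta)$. A convergence structure on a set specifies for each point $x$ the nets converging to $x$, such that constant nets converge, quasi-subnets of a net converging to $x$ converge to $x$, and if $x_\alpha\to x$, $y_\alpha\to x$ (same index set) and $z_\alpha\in\{x_\alpha,y_\alpha\}$ for all $\alpha$, then $z_\alpha\to x$. The tail filter $[x_\alpha]$ consists of all sets containing a tail of $(x_\alpha)$; a filter $\mathcal F$ converges to $x$ if $\mathcal F=[x_\alpha]$ for some net $x_\alpha\to x$. For a filter base $\mathcal B$, $[\mathcal B]$ is the filter it generates. A convergence structure is first countable if whenever a filter $\mathcal F\to x$ there is a filter $\mathcal G\subseteq\mathcal F$ with a countable base such that $\mathcal G\to x$. It is strongly first countable if for every $x$ there is a countable collection $\mathcal H$ of subsets such that whenever $\mathcal F\to x$ there is a filter base $\mathcal B\subseteq\mathcal F\cap\mathcal H$ with $[\mathcal B]\to x$. Relative uniform convergence: $x_\alpha\xrightarrow{\mathrm{ru}}x$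 if there is $u\in X_+$ such that for every $\varepsilon>0$ there is $\alpha_\varepsilon$ with $|x-x_\alpha|\le\varepsilon u$ for all $\alpha\ge\alpha_\varepsilon$. Its unbounded modification: $x_\alpha\xrightarrow{\mathrm{uru}}x$ if $y\wedge|x-x_\alpha|\xrightarrow{\mathrm{ru}}0$ for all $y\in X_+$. $I_C$ denotes the ideal (solid linear subspace) generated by $C$. *)

theory Defs
  imports "HOL-Analysis.Analysis" "HOL-Library.Lattice_Algebras"
begin

section \<open>Vector lattices\<close>

class vector_lattice = ordered_real_vector + lattice_ab_group_add_abs

class archimedean_vector_lattice = vector_lattice +
  assumes archimedean: "0 \<le> x \<Longrightarrow> (\<And>n::nat. real n *\<^sub>R x \<le> y) \<Longrightarrow> x = 0"

definition solid :: "'a::vector_lattice set \<Rightarrow> bool"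
  where "solid S \<longleftrightarrow> (\<forall>x\<in>S. \<forall>y. \<bar>y\<bar> \<le> \<bar>x\<bar> \<longrightarrow> y \<in> S)"

definition vl_ideal :: "'a::vector_lattice set \<Rightarrow> bool"
  where "vl_ideal S \<longleftrightarrow> subspace S \<and> solid S"

definition ideal_generated :: "'a::vector_lattice set \<Rightarrow> 'a set"
  where "ideal_generated C = vl_ideal hull C"


section \<open>Nets\<close>

text \<open>
  The index set is an arbitrary subset of the type \<open>'i\<close>; \<^term>\<open>leq\<close> and
  \<^term>\<open>elem\<close> matter only on the index set.
\<close>

record ('i, 'a) net =
  index :: "'i set"
  leq :: "'i \<Rightarrow> 'i \<Rightarrow> bool"
  elem :: "'i \<Rightarrow> 'a"

definition is_net :: "('i, 'a) net \<Rightarrow> bool"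
  where "is_net N \<longleftrightarrow>
    index N \<noteq> {} \<and>
    (\<forall>a\<in>index N. leq N a a) \<and>
    (\<forall>a\<in>index N. \<forall>b\<in>index N. \<forall>c\<in>index N. leq N a b \<longrightarrow> leq N b c \<longrightarrow> leq N a c) \<and>
    (\<forall>a\<in>index N. \<forall>b\<in>index N. \<exists>c\<in>index N. leq N a c \<and> leq N b c)"

definition tail :: "('i, 'a) net \<Rightarrow> 'i \<Rightarrow> 'a set"
  where "tail N a = elem N ` {b \<in> index N. leq N a b}"

definition quasi_subnet :: "('i, 'a) net \<Rightarrow> ('i, 'a) net \<Rightarrow> bool"
  where "quasi_subnet M N \<longleftrightarrow> (\<forall>a\<in>index N. \<exists>b\<in>index M. tail M b \<subseteq> tail N a)"


section \<open>Filters\<close>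

text \<open>
  A set \<open>A\<close> belongs to a filter \<open>F\<close> iff \<^term>\<open>eventually (\<lambda>x. x \<in> A) F\<close>. In the library's
  order \<^term>\<open>F \<le> G\<close> means that every set belonging to \<open>G\<close> belongs to \<open>F\<close>, that is,
  \<open>G \<subseteq> F\<close> as families of sets.
\<close>

definition tail_filter :: "('i, 'a) net \<Rightarrow> 'a filter"
  where "tail_filter N = (INF a\<in>index N. principal (tail N a))"

lemma is_net_nonempty: "is_net N \<Longrightarrow> index N \<noteq> {}"
  unfolding is_net_def by (elim conjE)

lemma is_net_trans:
  "is_net N \<Longrightarrow>
    \<forall>a\<in>index N. \<forall>b\<in>index N. \<forall>c\<in>index N. leq N a b \<longrightarrow> leq N b c \<longrightarrow> leq N a c"
  unfolding is_net_def by (elim conjE)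

lemma is_net_directed:
  "is_net N \<Longrightarrow>
    \<forall>a\<in>index N. \<forall>b\<in>index N. \<exists>c\<in>index N. leq N a c \<and> leq N b c"
  unfolding is_net_def by (elim conjE)

lemma tail_mono:
  assumes "is_net N" "a \<in> index N" "c \<in> index N" "leq N a c"
  shows "tail N c \<subseteq> tail N a"
proof -
  have "leq N a d" if "d \<in> index N" "leq N c d" for d
    using is_net_trans[OF assms(1), rule_format, OF assms(2) assms(3) that(1) assms(4) that(2)] .
  then show ?thesis
    unfolding tail_def by (intro image_mono) auto
qed

lemma eventually_tail_filter:
  assumes "is_net N"
  shows "eventually P (tail_filter N) \<longleftrightarrow> (\<exists>a\<in>index N. \<forall>x\<in>tail N a. P x)"
proof -
  have *: "\<exists>c\<in>index N. principal (tail N c) \<le> inf (principal (tail N a)) (principal (tail N b))"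
    if ab: "a \<in> index N" "b \<in> index N" for a b
  proof -
    obtain c where c: "c \<in> index N" "leq N a c" "leq N b c"
      using is_net_directed[OF assms, rule_format, OF ab] by (elim bexE conjE)
    have "principal (tail N c) \<le> inf (principal (tail N a)) (principal (tail N b))"
      using tail_mono[OF assms ab(1) c(1,2)] tail_mono[OF assms ab(2) c(1,3)] by simp
    then show ?thesis
      using c(1) by (rule bexI)
  qed
  have "eventually P (tail_filter N) \<longleftrightarrow> (\<exists>a\<in>index N. eventually P (principal (tail N a)))"
    unfolding tail_filter_def using is_net_nonempty[OF assms] * by (rule eventually_INF_base)
  then show ?thesis
    by (simp only: eventually_principal)
qed

text \<open>The empty set is excluded, so that a filter base generates a proper filter.\<close>

definition filter_base :: "'a set set \<Rightarrow> bool"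
  where "filter_base \<B> \<longleftrightarrow>
    \<B> \<noteq> {} \<and> {} \<notin> \<B> \<and> (\<forall>A\<in>\<B>. \<forall>B\<in>\<B>. \<exists>C\<in>\<B>. C \<subseteq> A \<inter> B)"

definition filter_generated :: "'a set set \<Rightarrow> 'a filter"
  where "filter_generated \<B> = (INF B\<in>\<B>. principal B)"

lemma eventually_filter_generated:
  assumes "filter_base \<B>"
  shows "eventually P (filter_generated \<B>) \<longleftrightarrow> (\<exists>B\<in>\<B>. \<forall>x\<in>B. P x)"
proof -
  have "eventually P (filter_generated \<B>) \<longleftrightarrow> (\<exists>B\<in>\<B>. eventually P (principal B))"
    unfolding filter_generated_def
  proof (rule eventually_INF_base)
    show "\<B> \<noteq> {}" using assms unfolding filter_base_def by (elim conjE)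
    fix A B assume AB: "A \<in> \<B>" "B \<in> \<B>"
    have "\<forall>A\<in>\<B>. \<forall>B\<in>\<B>. \<exists>C\<in>\<B>. C \<subseteq> A \<inter> B" using assms unfolding filter_base_def by (elim conjE)
    from bspec[OF bspec[OF this AB(1)] AB(2)] 
    show "\<exists>C\<in>\<B>. principal C \<le> inf (principal A) (principal B)"
      by (simp only: inf_principal principal_le_iff)
  qed
  then show ?thesis
    by (simp only: eventually_principal)
qed

definition countably_based :: "'a filter \<Rightarrow> bool"
  where "countably_based G \<longleftrightarrow> (\<exists>\<B>. countable \<B> \<and> filter_base \<B> \<and> filter_generated \<B> = G)"


section \<open>Convergence structures\<close>

text \<open>
  A notion of convergence \<^term>\<open>conv\<close> speaks about nets indexed by subsets of a fixed type
  \<open>'i\<close>, as HOL cannot quantify over all index sets at once. This is no restriction as soon as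
  \<open>'a \<times> 'a set\<close> injects into \<open>'i\<close>: every proper filter \<open>F\<close> on \<open>'a\<close> is then the tail filter of
  such a net (take the pairs \<open>(x, A)\<close> with \<open>x \<in> A\<close> and \<open>A\<close> belonging to \<open>F\<close>, ordered by reverse
  inclusion of the second components). Hence every net, over any index set whatsoever, has the
  same tail filter as a net over \<open>'i\<close>, each of the two being a quasi-subnet of the other. On a
  smaller index type \<^term>\<open>filter_conv\<close> below can miss filters.
\<close>

definition convergence_structure :: "(('i, 'a) net \<Rightarrow> 'a \<Rightarrow> bool) \<Rightarrow> bool"
  where "convergence_structure conv \<longleftrightarrow>
    (\<forall>N x. is_net N \<longrightarrow> (\<forall>a\<in>index N. elem N a = x) \<longrightarrow> conv N x) \<and>
    (\<forall>M N x. is_net M \<longrightarrow> is_net N \<longrightarrow> quasi_subnet M N \<longrightarrow> conv N x \<longrightarrow> conv M x) \<and>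
    (\<forall>N y z x. is_net N \<longrightarrow> conv N x \<longrightarrow> conv (N\<lparr>elem := y\<rparr>) x \<longrightarrow>
        (\<forall>a\<in>index N. z a \<in> {elem N a, y a}) \<longrightarrow> conv (N\<lparr>elem := z\<rparr>) x)"

definition filter_conv :: "(('i, 'a) net \<Rightarrow> 'a \<Rightarrow> bool) \<Rightarrow> 'a filter \<Rightarrow> 'a \<Rightarrow> bool"
  where "filter_conv conv F x \<longleftrightarrow> (\<exists>N. is_net N \<and> conv N x \<and> F = tail_filter N)"

definition first_countable_conv :: "(('i, 'a) net \<Rightarrow> 'a \<Rightarrow> bool) \<Rightarrow> bool"
  where "first_countable_conv conv \<longleftrightarrow>
    convergence_structure conv \<and>
    (\<forall>F x. filter_conv conv F x \<longrightarrow>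
      (\<exists>G. F \<le> G \<and> countably_based G \<and> filter_conv conv G x))"

definition strongly_first_countable_conv :: "(('i, 'a) net \<Rightarrow> 'a \<Rightarrow> bool) \<Rightarrow> bool"
  where "strongly_first_countable_conv conv \<longleftrightarrow>
    convergence_structure conv \<and>
    (\<forall>x. \<exists>\<H>. countable \<H> \<and>
      (\<forall>F. filter_conv conv F x \<longrightarrow>
        (\<exists>\<B>. filter_base \<B> \<and> \<B> \<subseteq> {A. eventually (\<lambda>y. y \<in> A) F} \<inter> \<H> \<and>
          filter_conv conv (filter_generated \<B>) x)))"


section \<open>Relative uniform convergence and its unbounded modification\<close>

definition ru :: "('i, 'a::vector_lattice) net \<Rightarrow> 'a \<Rightarrow> bool"
  where "ru N x \<longleftrightarrow>
    (\<exists>u\<ge>0. \<forall>\<epsilon>>0. \<exists>a\<in>index N. \<forall>b\<in>index N. leq N a b \<longrightarrow> \<bar>x - elem N b\<bar> \<le> \<epsilon> *\<^sub>R u)"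

definition uru :: "('i, 'a::vector_lattice) net \<Rightarrow> 'a \<Rightarrow> bool"
  where "uru N x \<longleftrightarrow> (\<forall>y\<ge>0. ru (N\<lparr>elem := \<lambda>a. inf y \<bar>x - elem N a\<bar>\<rparr>) 0)"

end

theory Submission
  imports Defs
begin

text \<open>
  Both convergences depend only on the tail filter of a net, so everything can be said in terms of
  filters. If \<open>F\<close> converges to \<open>x\<close> relatively uniformly with regulator \<open>u\<close>, then so does the filter
  generated by the sets \<open>{z. \<bar>x - z\<bar> \<le> u / n}\<close>. Under (i) the regulators may be taken from a fixed
  countable set \<open>D\<close> that is cofinal in \<open>X\<close>, which leaves countably many such sets; for \<open>uru\<close> the truncating
  elements \<open>y\<close> may be taken from \<open>D\<close> as well. Conversely, let \<open>\<H>\<close> witness strong first countability at \<open>0\<close>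
  and choose an upper bound for each order bounded member of \<open>\<H>\<close>. Given \<open>u \<ge> 0\<close>, the filter of the
  sets \<open>{z. \<bar>z\<bar> \<le> u / n}\<close> converges to \<open>0\<close>, so some order bounded member of \<open>\<H>\<close> contains some \<open>u / n\<close>;
  hence the chosen bounds generate \<open>X\<close> as an ideal.
\<close>

section \<open>Convergences determined by tail filters\<close>

lemma is_net_elem_update [simp]: "is_net (N\<lparr>elem := y\<rparr>) \<longleftrightarrow> is_net N"
  by (simp add: is_net_def)

lemma eventually_tail_filter_elem:
  assumes "is_net N"
  shows "eventually P (tail_filter N) \<longleftrightarrow>
    (\<exists>a\<in>index N. \<forall>b\<in>index N. leq N a b \<longrightarrow> P (elem N b))"
  unfolding eventually_tail_filter[OF assms] by (auto simp: tail_def)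

lemma tail_filter_neq_bot:
  assumes "is_net N"
  shows "tail_filter N \<noteq> bot"
proof
  assume "tail_filter N = bot"
  then have "eventually (\<lambda>_. False) (tail_filter N)" by simp
  then show False
    using is_net_directed[OF assms] unfolding eventually_tail_filter_elem[OF assms] by blast
qed

lemma quasi_subnet_imp_tail_filter_le:
  assumes "is_net M" "is_net N" "quasi_subnet M N"
  shows "tail_filter M \<le> tail_filter N"
  using assms(3) unfolding le_filter_def eventually_tail_filter[OF assms(1)]
    eventually_tail_filter[OF assms(2)] quasi_subnet_def by blast

lemma tail_filter_constant:
  assumes "is_net N" "\<And>a. a \<in> index N \<Longrightarrow> elem N a = x"
  shows "tail_filter N \<le> principal {x}"
  unfolding le_principal eventually_tail_filter_elem[OF assms(1)]
  using is_net_nonempty[OF assms(1)] assms(2) by auto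

text \<open>Beyond a common upper bound of two indices, each value of \<open>z\<close> is one of two
  values that both satisfy the predicate. This turns the mixing axiom into closure under
  \<open>sup\<close>.\<close>

lemma tail_filter_mix:
  assumes N: "is_net N" and z: "\<And>a. a \<in> index N \<Longrightarrow> z a \<in> {elem N a, y a}"
  shows "tail_filter (N\<lparr>elem := z\<rparr>) \<le> sup (tail_filter N) (tail_filter (N\<lparr>elem := y\<rparr>))"
  unfolding le_filter_def eventually_sup
proof (intro allI impI, elim conjE)
  fix P
  assume "eventually P (tail_filter N)" "eventually P (tail_filter (N\<lparr>elem := y\<rparr>))"
  then obtain a b where a: "a \<in> index N" "\<And>d. d \<in> index N \<Longrightarrow> leq N a d \<Longrightarrow> P (elem N d)"
    and b: "b \<in> index N" "\<And>d. d \<in> index N \<Longrightarrow> leq N b d \<Longrightarrow> P (y d)"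
    using N by (auto simp: eventually_tail_filter_elem)
  obtain c where c: "c \<in> index N" "leq N a c" "leq N b c"
    using is_net_directed[OF N] a(1) b(1) by blast
  have "P (z d)" if d: "d \<in> index N" "leq N c d" for d
  proof -
    have "leq N a d" "leq N b d"
      using is_net_trans[OF N] a(1) b(1) c d by blast+
    then show ?thesis
      using a(2) b(2) d(1) z[OF d(1)] by auto
  qed
  then show "eventually P (tail_filter (N\<lparr>elem := z\<rparr>))"
    using N c(1) by (auto simp: eventually_tail_filter_elem)
qed

text \<open>Constant nets are covered by \<open>const\<close> and \<open>anti\<close>, quasi-subnets
  by \<open>anti\<close> since their tail filters are smaller, and mixtures by \<open>sup\<close>
  followed by \<open>anti\<close>.\<close>

lemma convergence_structure_tail_filterI:
  fixes conv :: "('i, 'a) net \<Rightarrow> 'a \<Rightarrow> bool"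
  assumes conv: "\<And>N x. is_net N \<Longrightarrow> conv N x \<longleftrightarrow> \<phi> (tail_filter N) x"
    and anti: "\<And>F G x. F \<le> G \<Longrightarrow> \<phi> G x \<Longrightarrow> \<phi> F x"
    and sup: "\<And>F G x. \<phi> F x \<Longrightarrow> \<phi> G x \<Longrightarrow> \<phi> (sup F G) x"
    and const: "\<And>x. \<phi> (principal {x}) x"
  shows "convergence_structure conv"
  unfolding convergence_structure_def
proof (intro conjI allI impI)
  fix N :: "('i, 'a) net" and x assume N: "is_net N" and "\<forall>a\<in>index N. elem N a = x"
  then have "tail_filter N \<le> principal {x}" by (simp add: tail_filter_constant)
  then show "conv N x"
    unfolding conv[OF N] using const by (rule anti)
next
  fix M N :: "('i, 'a) net" and x 
  assume M: "is_net M" and N: "is_net N" and MN: "quasi_subnet M N" and "conv N x"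
  then show "conv M x"
    using anti[OF quasi_subnet_imp_tail_filter_le[OF M N MN]] by (simp add: conv)
next
  fix N :: "('i, 'a) net" and y z x
  assume N: "is_net N" and c: "conv N x" "conv (N\<lparr>elem := y\<rparr>) x"
    and z: "\<forall>a\<in>index N. z a \<in> {elem N a, y a}"
  have "\<phi> (sup (tail_filter N) (tail_filter (N\<lparr>elem := y\<rparr>))) x"
    using N c conv by (intro sup) auto
  then have "\<phi> (tail_filter (N\<lparr>elem := z\<rparr>)) x"
    by (rule anti[rotated]) (rule tail_filter_mix[OF N], use z in blast)
  then show "conv (N\<lparr>elem := z\<rparr>) x"
    using N conv by simp
qed

section \<open>Proper filters as tail filters of nets\<close>

text \<open>Properness puts a point into each member \<open>A\<close> of the filter, so the pairs
  \<open>(x, A)\<close>, carried over by \<open>f\<close>, are directed; the tail from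
  \<open>(x, A)\<close> is exactly \<open>A\<close>.\<close>

lemma proper_filter_is_tail_filter:
  fixes F :: "'a filter"
  assumes "\<exists>f :: 'a \<times> 'a set \<Rightarrow> 'i. inj f" and F: "F \<noteq> bot"
  shows "\<exists>N :: ('i, 'a) net. is_net N \<and> tail_filter N = F"
proof -
  obtain f :: "'a \<times> 'a set \<Rightarrow> 'i" where f: "inj f" using assms(1) by blast
  define K where "K = {(x, A). x \<in> A \<and> eventually (\<lambda>y. y \<in> A) F}"
  \<comment> \<open>\<open>inv f\<close> decodes an index into its pair. The order compares second
    components alone, hence is only a preorder.\<close>
  define N :: "('i, 'a) net" where
    "N = \<lparr>index = f ` K, leq = (\<lambda>i j. snd (inv f j) \<subseteq> snd (inv f i)), elem = fst \<circ> inv f\<rparr>"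
  have K: "\<exists>x. (x, A) \<in> K" if "eventually (\<lambda>y. y \<in> A) F" for A
    using eventually_happens'[OF F that] that by (auto simp: K_def)
  have N: "is_net N"
    unfolding is_net_def
  proof (intro conjI)
    show "index N \<noteq> {}"
      using K[of UNIV] by (auto simp: N_def)
    have "\<exists>k\<in>K. snd k \<subseteq> snd i \<and> snd k \<subseteq> snd j" if ij: "i \<in> K" "j \<in> K" for i j
    proof -
      have "eventually (\<lambda>y. y \<in> snd i \<inter> snd j) F"
        using ij by (auto simp: K_def eventually_conj_iff)
      from K[OF this] obtain x where "(x, snd i \<inter> snd j) \<in> K" by blast
      then show ?thesis by (rule bexI[rotated]) simp
    qed
    then show "\<forall>a\<in>index N. \<forall>b\<in>index N. \<exists>c\<in>index N. leq N a c \<and> leq N b c"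
      using f by (simp add: N_def)
  qed (use f in \<open>auto simp: N_def\<close>)
  have tail: "tail N (f (x, A)) = A" if "(x, A) \<in> K" for x A
  proof -
    have "tail N (f (x, A)) = fst ` {k \<in> K. snd k \<subseteq> A}"
      unfolding tail_def by (force simp: N_def image_iff f)
    \<comment> \<open>Each y in \<open>A\<close> is the first component of the pair
      \<open>(y, A)\<close>, which itself lies in \<open>K\<close>.\<close>
    also have "\<dots> = A"
      using that by (force simp: K_def)
    finally show ?thesis .
  qed
  have "eventually P (tail_filter N) \<longleftrightarrow> eventually P F" for P
  proof
    assume "eventually P (tail_filter N)"
    then obtain x A where xA: "(x, A) \<in> K" "\<forall>y\<in>tail N (f (x, A)). P y"
      unfolding eventually_tail_filter[OF N] by (auto simp: N_def)
    then have "\<forall>y\<in>A. P y" by (simp add: tail)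
    then show "eventually P F"
      using xA(1) by (auto simp: K_def elim: eventually_mono)
  next
    assume "eventually P F"
    then obtain x where "(x, Collect P) \<in> K"
      using K[of "Collect P"] by auto
    then show "eventually P (tail_filter N)"
      unfolding eventually_tail_filter[OF N]
      by (intro bexI[of _ "f (x, Collect P)"]) (auto simp: tail, simp add: N_def)
  qed
  then show ?thesis using N by (auto simp: filter_eq_iff)
qed

text \<open>This removes nets from the countability arguments: tail filters are proper, and the
  large index type makes every proper filter a tail filter.\<close>

lemma filter_conv_iff:
  fixes conv :: "('i, 'a) net \<Rightarrow> 'a \<Rightarrow> bool"
  assumes "\<exists>f :: 'a \<times> 'a set \<Rightarrow> 'i. inj f"
    and conv: "\<And>N x. is_net N \<Longrightarrow> conv N x \<longleftrightarrow> \<phi> (tail_filter N) x"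
  shows "filter_conv conv F x \<longleftrightarrow> F \<noteq> bot \<and> \<phi> F x"
proof
  assume "filter_conv conv F x"
  then obtain N :: "('i, 'a) net" where "is_net N" "conv N x" "F = tail_filter N"
    unfolding filter_conv_def by blast
  then show "F \<noteq> bot \<and> \<phi> F x"
    by (simp add: conv tail_filter_neq_bot)
next
  assume F: "F \<noteq> bot \<and> \<phi> F x"
  then obtain N :: "('i, 'a) net" where "is_net N" "tail_filter N = F"
    using proper_filter_is_tail_filter[OF assms(1)] by blast
  then show "filter_conv conv F x"
    using F unfolding filter_conv_def by (auto simp: conv intro!: exI[of _ N])
qed

section \<open>Filters generated by countably many sets\<close>

text \<open>The empty subfamily is allowed and contributes \<open>UNIV\<close>, so the result is
  nonempty for every \<S>.\<close>

definition finite_inters :: "'a set set \<Rightarrow> 'a set set"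
  where "finite_inters \<S> = Inter ` {\<F>. finite \<F> \<and> \<F> \<subseteq> \<S>}"

lemma countable_finite_inters: "countable \<S> \<Longrightarrow> countable (finite_inters \<S>)"
  unfolding finite_inters_def by (intro countable_image countable_Collect_finite_subset)

lemma finite_inters_mono: "\<S> \<subseteq> \<T> \<Longrightarrow> finite_inters \<S> \<subseteq> finite_inters \<T>"
  unfolding finite_inters_def by blast

lemma subset_finite_inters: "\<S> \<subseteq> finite_inters \<S>"
proof
  fix A assume "A \<in> \<S>"
  then show "A \<in> finite_inters \<S>"
    unfolding finite_inters_def by (intro image_eqI[of _ _ "{A}"]) auto
qed

text \<open>The common point \<open>x\<close> survives in every finite intersection, which excludes
  the empty set.\<close>

lemma filter_base_finite_inters:
  assumes "\<And>A. A \<in> \<S> \<Longrightarrow> x \<in> A"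
  shows "filter_base (finite_inters \<S>)"
  unfolding filter_base_def
proof (intro conjI ballI)
  show "finite_inters \<S> \<noteq> {}" by (auto simp: finite_inters_def)
  show "{} \<notin> finite_inters \<S>"
    using assms by (fastforce simp: finite_inters_def)
  fix A B assume "A \<in> finite_inters \<S>" "B \<in> finite_inters \<S>"
  then obtain \<F> \<G> where *: "A = \<Inter>\<F>" "B = \<Inter>\<G>" "finite \<F>" "finite \<G>" "\<F> \<subseteq> \<S>" "\<G> \<subseteq> \<S>"
    by (auto simp: finite_inters_def)
  then have "\<Inter>(\<F> \<union> \<G>) \<in> finite_inters \<S>"
    unfolding finite_inters_def by (intro imageI) auto
  then show "\<exists>C\<in>finite_inters \<S>. C \<subseteq> A \<inter> B"
    using * by (intro bexI[of _ "\<Inter>(\<F> \<union> \<G>)"]) auto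
qed

lemma eventually_finite_inters:
  assumes "B \<in> finite_inters \<S>" "\<And>A. A \<in> \<S> \<Longrightarrow> eventually (\<lambda>z. z \<in> A) F"
  shows "eventually (\<lambda>z. z \<in> B) F"
proof -
  obtain \<F> where "finite \<F>" "\<F> \<subseteq> \<S>" "B = \<Inter>\<F>"
    using assms(1) by (auto simp: finite_inters_def)
  then show ?thesis
    using assms(2) by (auto simp: eventually_ball_finite_distrib)
qed

lemma eventually_mem_mono:
  "eventually (\<lambda>z. z \<in> A) F \<Longrightarrow> A \<subseteq> B \<Longrightarrow> eventually (\<lambda>z. z \<in> B) F"
  by (erule eventually_mono) blast

lemma filter_generated_neq_bot:
  assumes "filter_base \<B>"
  shows "filter_generated \<B> \<noteq> bot"
proof
  assume "filter_generated \<B> = bot"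
  then have "eventually (\<lambda>_. False) (filter_generated \<B>)" by simp
  then show False
    using assms unfolding eventually_filter_generated[OF assms] filter_base_def by auto
qed

lemma eventually_filter_generated_mem:
  "filter_base \<B> \<Longrightarrow> B \<in> \<B> \<Longrightarrow> eventually (\<lambda>z. z \<in> B) (filter_generated \<B>)"
  by (auto simp: eventually_filter_generated)

section \<open>Criteria for first and strong first countability\<close>

text \<open>The coarser filter is generated by the finite intersections of \<S>: they belong to
  \<open>F\<close>, there are countably many, and the members of \<S> among them force
  convergence.\<close>

lemma first_countable_convI:
  assumes "convergence_structure conv"
    and conv: "\<And>F x. filter_conv conv F x \<longleftrightarrow> F \<noteq> bot \<and> \<phi> F x"
    and ex: "\<And>F x. \<phi> F x \<Longrightarrow> \<exists>\<S>. countable \<S> \<and> (\<forall>A\<in>\<S>. x \<in> A \<and> eventually (\<lambda>z. z \<in> A) F) \<and>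
      (\<forall>G. (\<forall>A\<in>\<S>. eventually (\<lambda>z. z \<in> A) G) \<longrightarrow> \<phi> G x)"
  shows "first_countable_conv conv"
  unfolding first_countable_conv_def
proof (intro conjI allI impI)
  fix F x assume "filter_conv conv F x"
  then obtain \<S> where \<S>: "countable \<S>" "\<And>A. A \<in> \<S> \<Longrightarrow> x \<in> A"
    "\<And>A. A \<in> \<S> \<Longrightarrow> eventually (\<lambda>z. z \<in> A) F"
    "\<And>G. (\<forall>A\<in>\<S>. eventually (\<lambda>z. z \<in> A) G) \<Longrightarrow> \<phi> G x"
    unfolding conv using ex[of F x] by blast
  define G where "G = filter_generated (finite_inters \<S>)"
  have base: "filter_base (finite_inters \<S>)"
    using \<S>(2) by (rule filter_base_finite_inters)
  have "F \<le> G"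
    unfolding le_filter_def G_def eventually_filter_generated[OF base]
    by (auto intro: eventually_mono[OF eventually_finite_inters[OF _ \<S>(3)]])
  moreover have "countably_based G"
    unfolding countably_based_def G_def using base countable_finite_inters[OF \<S>(1)] by blast
  moreover have "filter_conv conv G x"
    unfolding conv G_def
    using filter_generated_neq_bot[OF base] eventually_filter_generated_mem[OF base]
      subset_finite_inters by (blast intro: \<S>(4))
  ultimately show "\<exists>G. F \<le> G \<and> countably_based G \<and> filter_conv conv G x" by blast
qed fact

text \<open>The finite intersections of \<T> serve as \<H> for all filters at once; only the
  subfamily \<S>, whose finite intersections form the base, depends on \<open>F\<close>.\<close>

lemma strongly_first_countable_convI:
  assumes "convergence_structure conv"
    and conv: "\<And>F x. filter_conv conv F x \<longleftrightarrow> F \<noteq> bot \<and> \<phi> F x"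
    and ex: "\<And>x. \<exists>\<T>. countable \<T> \<and> (\<forall>A\<in>\<T>. x \<in> A) \<and>
      (\<forall>F. \<phi> F x \<longrightarrow> (\<exists>\<S>\<subseteq>\<T>. (\<forall>A\<in>\<S>. eventually (\<lambda>z. z \<in> A) F) \<and>
        (\<forall>G. (\<forall>A\<in>\<S>. eventually (\<lambda>z. z \<in> A) G) \<longrightarrow> \<phi> G x)))"
  shows "strongly_first_countable_conv conv"
  unfolding strongly_first_countable_conv_def
proof (intro conjI allI)
  fix x
  obtain \<T> where \<T>: "countable \<T>" "\<And>A. A \<in> \<T> \<Longrightarrow> x \<in> A"
    "\<And>F. \<phi> F x \<Longrightarrow> \<exists>\<S>\<subseteq>\<T>. (\<forall>A\<in>\<S>. eventually (\<lambda>z. z \<in> A) F) \<and>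
      (\<forall>G. (\<forall>A\<in>\<S>. eventually (\<lambda>z. z \<in> A) G) \<longrightarrow> \<phi> G x)"
    using ex[of x] by auto
  have "\<exists>\<B>. filter_base \<B> \<and> \<B> \<subseteq> {A. eventually (\<lambda>y. y \<in> A) F} \<inter> finite_inters \<T> \<and>
      filter_conv conv (filter_generated \<B>) x" if F: "filter_conv conv F x" for F
  proof -
    obtain \<S> where \<S>: "\<S> \<subseteq> \<T>" "\<And>A. A \<in> \<S> \<Longrightarrow> eventually (\<lambda>z. z \<in> A) F"
      "\<And>G. (\<forall>A\<in>\<S>. eventually (\<lambda>z. z \<in> A) G) \<Longrightarrow> \<phi> G x"
      using F \<T>(3)[of F] unfolding conv by blast
    have base: "filter_base (finite_inters \<S>)"
      using \<T>(2) \<S>(1) by (intro filter_base_finite_inters[of _ x]) blast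
    moreover have "filter_conv conv (filter_generated (finite_inters \<S>)) x"
      unfolding conv
      using filter_generated_neq_bot[OF base] eventually_filter_generated_mem[OF base]
        subset_finite_inters by (blast intro: \<S>(3))
    moreover have "finite_inters \<S> \<subseteq> {A. eventually (\<lambda>y. y \<in> A) F} \<inter> finite_inters \<T>"
      using eventually_finite_inters[OF _ \<S>(2)] finite_inters_mono[OF \<S>(1)] by blast
    ultimately show ?thesis by blast
  qed
  then show "\<exists>\<H>. countable \<H> \<and> (\<forall>F. filter_conv conv F x \<longrightarrow>
      (\<exists>\<B>. filter_base \<B> \<and> \<B> \<subseteq> {A. eventually (\<lambda>y. y \<in> A) F} \<inter> \<H> \<and>
        filter_conv conv (filter_generated \<B>) x))"
    using countable_finite_inters[OF \<T>(1)] by blast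
qed fact

section \<open>Relative uniform convergence of filters\<close>

text \<open>The bound is one-sided because \<open>g\<close> will be a distance to x or such a
  distance truncated by a nonnegative element.\<close>

definition ru_null :: "('b \<Rightarrow> 'a::vector_lattice) \<Rightarrow> 'b filter \<Rightarrow> bool"
  where "ru_null g F \<longleftrightarrow> (\<exists>u\<ge>0. \<forall>\<epsilon>>0. eventually (\<lambda>z. g z \<le> \<epsilon> *\<^sub>R u) F)"

definition sublevel :: "('b \<Rightarrow> 'a::vector_lattice) \<Rightarrow> 'a \<Rightarrow> nat \<Rightarrow> 'b set"
  where "sublevel g u n = {z. g z \<le> inverse (real (Suc n)) *\<^sub>R u}"

text \<open>By the Archimedean property of the reals, the countably many values 1, 1/2, 1/3, ...
  suffice for \<epsilon>; \<open>0 \<le> u\<close> makes the bound increase with \<epsilon>.\<close>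

lemma regulator_iff_sublevels:
  assumes "0 \<le> u"
  shows "(\<forall>\<epsilon>>0. eventually (\<lambda>z. g z \<le> \<epsilon> *\<^sub>R u) F) \<longleftrightarrow>
    (\<forall>n. eventually (\<lambda>z. z \<in> sublevel g u n) F)"
proof (intro iffI allI impI)
  fix \<epsilon> :: real assume ev: "\<forall>n. eventually (\<lambda>z. z \<in> sublevel g u n) F" and "0 < \<epsilon>"
  then obtain n where n: "inverse (real (Suc n)) < \<epsilon>"
    using reals_Archimedean by blast
  have "g z \<le> \<epsilon> *\<^sub>R u" if "z \<in> sublevel g u n" for z
    using that scaleR_right_mono[OF less_imp_le[OF n] assms]
    unfolding sublevel_def mem_Collect_eq by (rule order_trans)
  then show "eventually (\<lambda>z. g z \<le> \<epsilon> *\<^sub>R u) F"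
    by (rule eventually_mono[OF ev[rule_format, of n]])
qed (auto simp: sublevel_def)

lemma ru_null_iff: "ru_null g F \<longleftrightarrow> (\<exists>u\<ge>0. \<forall>n. eventually (\<lambda>z. z \<in> sublevel g u n) F)"
  unfolding ru_null_def using regulator_iff_sublevels by blast

lemma sublevel_mono:
  assumes "u \<le> v"
  shows "sublevel g u n \<subseteq> sublevel g v n"
proof -
  have "inverse (real (Suc n)) *\<^sub>R u \<le> inverse (real (Suc n)) *\<^sub>R v"
    using assms by (intro scaleR_left_mono) auto
  then show ?thesis
    unfolding sublevel_def using order_trans by blast
qed

lemma mem_sublevel_zero: "0 \<le> u \<Longrightarrow> g x = 0 \<Longrightarrow> x \<in> sublevel g u n"
  by (simp add: sublevel_def scaleR_nonneg_nonneg)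

lemma ru_null_antimono: "F \<le> G \<Longrightarrow> ru_null g G \<Longrightarrow> ru_null g F"
  unfolding ru_null_def le_filter_def by blast

text \<open>The sum of the two regulators dominates both and so serves for both filters.\<close>

lemma ru_null_sup:
  assumes "ru_null g F" "ru_null g G"
  shows "ru_null g (sup F G)"
proof -
  obtain u v where u: "0 \<le> u" "\<And>n. eventually (\<lambda>z. z \<in> sublevel g u n) F"
    and v: "0 \<le> v" "\<And>n. eventually (\<lambda>z. z \<in> sublevel g v n) G"
    using assms unfolding ru_null_iff by blast
  have le: "u \<le> u + v" "v \<le> u + v" using u(1) v(1) by simp_all
  have "eventually (\<lambda>z. z \<in> sublevel g (u + v) n) (sup F G)" for n
    unfolding eventually_sup
    using eventually_mem_mono[OF u(2) sublevel_mono[OF le(1)]]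
      eventually_mem_mono[OF v(2) sublevel_mono[OF le(2)]] by blast
  moreover have "0 \<le> u + v" using u(1) v(1) by simp
  ultimately show ?thesis unfolding ru_null_iff by blast
qed

lemma ru_null_principal: "g x = 0 \<Longrightarrow> ru_null g (principal {x})"
  unfolding ru_null_iff
  by (intro exI[of _ 0]) (auto simp: eventually_principal mem_sublevel_zero)

text \<open>Used for \<open>uru\<close>, to pass from a truncating element in the cofinal set to a
  smaller one.\<close>

lemma ru_null_mono:
  assumes "ru_null g F" and le: "\<And>z. h z \<le> g z"
  shows "ru_null h F"
proof -
  have "sublevel g u n \<subseteq> sublevel h u n" for u n
    unfolding sublevel_def using le order_trans by blast
  then show ?thesis
    using assms(1) unfolding ru_null_iff by (blast intro: eventually_mem_mono)
qed

definition ru_filter :: "'a::vector_lattice filter \<Rightarrow> 'a \<Rightarrow> bool"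
  where "ru_filter F x \<longleftrightarrow> ru_null (\<lambda>z. \<bar>x - z\<bar>) F"

definition uru_filter :: "'a::vector_lattice filter \<Rightarrow> 'a \<Rightarrow> bool"
  where "uru_filter F x \<longleftrightarrow> (\<forall>y\<ge>0. ru_null (\<lambda>z. inf y \<bar>x - z\<bar>) F)"

lemma ru_iff_tail_filter: "is_net N \<Longrightarrow> ru N x \<longleftrightarrow> ru_filter (tail_filter N) x"
  by (simp add: ru_def ru_filter_def ru_null_def eventually_tail_filter_elem)

lemma uru_iff_tail_filter:
  assumes "is_net N"
  shows "uru N x \<longleftrightarrow> uru_filter (tail_filter N) x"
proof -
  have "ru (N\<lparr>elem := \<lambda>a. inf y \<bar>x - elem N a\<bar>\<rparr>) 0 \<longleftrightarrow>
      ru_null (\<lambda>z. inf y \<bar>x - z\<bar>) (tail_filter N)" if "0 \<le> y" for y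
  proof -
    \<comment> \<open>The truncated distance is nonnegative because \<open>y\<close> is, so the
      outer absolute value disappears.\<close>
    have *: "\<bar>0 - inf y \<bar>x - z\<bar>\<bar> = inf y \<bar>x - z\<bar>" for z
      using that by simp
    show ?thesis
      using assms * by (simp add: ru_def ru_null_def eventually_tail_filter_elem)
  qed
  then show ?thesis by (simp add: uru_def uru_filter_def)
qed

lemma convergence_structure_ru: "convergence_structure ru"
  by (rule convergence_structure_tail_filterI[of _ ru_filter])
    (auto simp: ru_iff_tail_filter ru_filter_def
      intro: ru_null_antimono ru_null_sup ru_null_principal)

lemma convergence_structure_uru: "convergence_structure uru"
  \<comment> \<open>\<open>inf_absorb2\<close> settles the condition for constant nets: at z = x the
    truncated distance is \<open>inf y 0 = 0\<close>.\<close>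
  by (rule convergence_structure_tail_filterI[of _ uru_filter])
    (auto simp: uru_iff_tail_filter uru_filter_def inf_absorb2
      intro: ru_null_antimono ru_null_sup ru_null_principal)

lemma first_countable_ru:
  assumes "\<exists>f :: 'a \<times> 'a set \<Rightarrow> 'i. inj f"
  shows "first_countable_conv (ru :: ('i, 'a::vector_lattice) net \<Rightarrow> 'a \<Rightarrow> bool)"
proof (rule first_countable_convI[of _ ru_filter])
  show "filter_conv (ru :: ('i, 'a) net \<Rightarrow> 'a \<Rightarrow> bool) F x \<longleftrightarrow> F \<noteq> bot \<and> ru_filter F x" for F x
    using assms(1) ru_iff_tail_filter by (rule filter_conv_iff)
  fix F :: "'a filter" and x
  assume "ru_filter F x"
  then obtain u where u: "0 \<le> u" "\<And>n. eventually (\<lambda>z. z \<in> sublevel (\<lambda>z. \<bar>x - z\<bar>) u n) F"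
    unfolding ru_filter_def ru_null_iff by blast
  show "\<exists>\<S>. countable \<S> \<and> (\<forall>A\<in>\<S>. x \<in> A \<and> eventually (\<lambda>z. z \<in> A) F) \<and>
      (\<forall>G. (\<forall>A\<in>\<S>. eventually (\<lambda>z. z \<in> A) G) \<longrightarrow> ru_filter G x)"
    using u unfolding ru_filter_def ru_null_iff
    by (intro exI[of _ "range (sublevel (\<lambda>z. \<bar>x - z\<bar>) u)"]) (auto simp: mem_sublevel_zero)
qed (rule convergence_structure_ru)

section \<open>Countable cofinal sets\<close>

lemma abs_scaleR_le: "\<bar>c *\<^sub>R v\<bar> \<le> \<bar>c\<bar> *\<^sub>R \<bar>v :: 'a::vector_lattice\<bar>"
proof (cases "0 \<le> c")
  case True
  then show ?thesis
    using scaleR_left_mono[OF abs_ge_self True, of v] scaleR_left_mono[OF abs_ge_minus_self True, of v]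
    by (intro abs_leI) auto
next
  case False
  then have c: "0 \<le> - c" by simp
  show ?thesis
    using False scaleR_left_mono[OF abs_ge_self c, of v] scaleR_left_mono[OF abs_ge_minus_self c, of v]
    by (intro abs_leI) auto
qed

text \<open>The finite sums of elements of \<open>C\<close> are cofinal: the elements whose absolute
  value lies below such a sum form an ideal containing \<open>C\<close>, which must be all of the
  space.\<close>

lemma countable_generated_imp_cofinal:
  fixes C :: "'a::vector_lattice set"
  assumes "countable C" "C \<subseteq> {0..}" "ideal_generated C = UNIV"
  obtains D where "countable D" "D \<subseteq> {0..}" "\<And>v :: 'a. \<exists>d\<in>D. v \<le> d"
proof
  \<comment> \<open>Lists permit repetitions, so \<open>D\<close> is closed under natural multiples;
    the empty list puts 0 into it.\<close>
  define D where "D = sum_list ` lists C"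
  show "countable D"
    unfolding D_def using assms(1) by (intro countable_image countable_lists)
  show "D \<subseteq> {0..}"
    using assms(2) by (auto simp: D_def intro!: sum_list_nonneg)
  have C_D: "C \<subseteq> D"
  proof
    fix c assume "c \<in> C"
    then have "sum_list [c] \<in> D" unfolding D_def by (intro imageI) simp
    then show "c \<in> D" by simp
  qed
  have zero: "0 \<in> D"
    unfolding D_def by (rule image_eqI[of _ _ "[]"]) simp_all
  have add: "d + e \<in> D" if de: "d \<in> D" "e \<in> D" for d e
  proof -
    obtain xs ys where "xs \<in> lists C" "ys \<in> lists C" "d = sum_list xs" "e = sum_list ys"
      using de unfolding D_def by blast
    then show ?thesis
      unfolding D_def by (intro image_eqI[of _ _ "xs @ ys"]) simp_all
  qed
  have mult: "real n *\<^sub>R d \<in> D" if "d \<in> D" for n d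
    using that by (induction n) (auto simp: zero add scaleR_left_distrib)
  define I where "I = {v. \<exists>d\<in>D. \<bar>v\<bar> \<le> d}"
  have "vl_ideal I"
    unfolding vl_ideal_def
  proof
    show "subspace I"
    proof (rule subspaceI)
      show "0 \<in> I" using zero by (auto simp: I_def)
      show "v + w \<in> I" if vw: "v \<in> I" "w \<in> I" for v w
      proof -
        obtain d e where "d \<in> D" "\<bar>v\<bar> \<le> d" "e \<in> D" "\<bar>w\<bar> \<le> e"
          using vw by (auto simp: I_def)
        then show ?thesis
          using add order_trans[OF abs_triangle_ineq add_mono] unfolding I_def by blast
      qed
      fix c v assume "v \<in> I"
      then obtain d where d: "d \<in> D" "\<bar>v\<bar> \<le> d" by (auto simp: I_def)
      \<comment> \<open>Since \<open>D\<close> is closed only under natural multiples, the scalar is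
        first rounded up.\<close>
      obtain n where n: "\<bar>c\<bar> \<le> real n" using real_arch_simple by blast
      have "\<bar>c *\<^sub>R v\<bar> \<le> \<bar>c\<bar> *\<^sub>R \<bar>v\<bar>" by (rule abs_scaleR_le)
      also have "\<dots> \<le> real n *\<^sub>R d"
        using n d(2) by (intro scaleR_mono) auto
      finally show "c *\<^sub>R v \<in> I"
        using mult[OF d(1)] by (auto simp: I_def)
    qed
    show "solid I"
      unfolding solid_def I_def by (auto intro: order_trans)
  qed
  moreover have "C \<subseteq> I"
    using C_D assms(2) by (force simp: I_def)
  ultimately have "ideal_generated C \<subseteq> I"
    unfolding ideal_generated_def by (intro hull_minimal)
  then have "v \<in> I" for v using assms(3) by blast
  then show "\<exists>d\<in>D. v \<le> d" for v
    using order_trans[OF abs_ge_self] unfolding I_def by blast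
qed

text \<open>Enlarging a regulator keeps it a regulator, so one can be found in
  \<open>D\<close>.\<close>

lemma ru_null_cofinal:
  assumes "\<And>v. \<exists>d\<in>D. v \<le> d" "ru_null g F"
  shows "\<exists>d\<in>D. \<forall>n. eventually (\<lambda>z. z \<in> sublevel g d n) F"
proof -
  obtain u where u: "\<And>n. eventually (\<lambda>z. z \<in> sublevel g u n) F"
    using assms(2) unfolding ru_null_iff by blast
  obtain d where d: "d \<in> D" "u \<le> d" using assms(1) by blast
  show ?thesis
    using eventually_mem_mono[OF u sublevel_mono[OF d(2)]] by (intro bexI[OF _ d(1)] allI)
qed

section \<open>Strong first countability from a countable cofinal set\<close>

lemma strongly_first_countable_ru:
  fixes D :: "'a::vector_lattice set"
  assumes "\<exists>f :: 'a \<times> 'a set \<Rightarrow> 'i. inj f"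
    and D: "countable D" "D \<subseteq> {0..}" "\<And>v. \<exists>d\<in>D. v \<le> d"
  shows "strongly_first_countable_conv (ru :: ('i, 'a) net \<Rightarrow> 'a \<Rightarrow> bool)"
proof (rule strongly_first_countable_convI[of _ ru_filter])
  show "filter_conv (ru :: ('i, 'a) net \<Rightarrow> 'a \<Rightarrow> bool) F x \<longleftrightarrow> F \<noteq> bot \<and> ru_filter F x" for F x
    using assms(1) ru_iff_tail_filter by (rule filter_conv_iff)
  fix x :: 'a
  let ?B = "sublevel (\<lambda>z. \<bar>x - z\<bar>)"
  \<comment> \<open>Regulators range over \<open>D\<close>; a given filter uses only the sets
    belonging to one regulator.\<close>
  let ?T = "(\<lambda>(d, n). ?B d n) ` (D \<times> UNIV)"
  have main: "\<exists>\<S>\<subseteq>?T. (\<forall>A\<in>\<S>. eventually (\<lambda>z. z \<in> A) F) \<and>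
      (\<forall>G. (\<forall>A\<in>\<S>. eventually (\<lambda>z. z \<in> A) G) \<longrightarrow> ru_filter G x)" if "ru_filter F x" for F
  proof -
    obtain d where d: "d \<in> D" "\<And>n. eventually (\<lambda>z. z \<in> ?B d n) F"
      using ru_null_cofinal[OF D(3)] \<open>ru_filter F x\<close> unfolding ru_filter_def by blast
    have "0 \<le> d" using d(1) D(2) by auto
    then have "ru_filter G x" if "\<forall>A\<in>range (?B d). eventually (\<lambda>z. z \<in> A) G" for G
      using that unfolding ru_filter_def ru_null_iff by blast
    moreover have "range (?B d) \<subseteq> ?T" using d(1) by force
    ultimately show ?thesis using d(2) by (intro exI[of _ "range (?B d)"]) blast
  qed
  show "\<exists>\<T>. countable \<T> \<and> (\<forall>A\<in>\<T>. x \<in> A) \<and>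
      (\<forall>F. ru_filter F x \<longrightarrow> (\<exists>\<S>\<subseteq>\<T>. (\<forall>A\<in>\<S>. eventually (\<lambda>z. z \<in> A) F) \<and>
        (\<forall>G. (\<forall>A\<in>\<S>. eventually (\<lambda>z. z \<in> A) G) \<longrightarrow> ru_filter G x)))"
  proof (rule exI[of _ ?T], intro conjI allI impI)
    show "countable ?T" using D(1) by simp
    show "\<forall>A\<in>?T. x \<in> A" using D(2) by (auto intro!: mem_sublevel_zero)
  qed (rule main)
qed (rule convergence_structure_ru)

text \<open>Each truncating element may need its own regulator. Both are taken from
  \<open>D\<close>, which leaves a family indexed by two elements of \<open>D\<close> and a natural
  number.\<close>

lemma strongly_first_countable_uru:
  fixes D :: "'a::vector_lattice set"
  assumes "\<exists>f :: 'a \<times> 'a set \<Rightarrow> 'i. inj f"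
    and D: "countable D" "D \<subseteq> {0..}" "\<And>v. \<exists>d\<in>D. v \<le> d"
  shows "strongly_first_countable_conv (uru :: ('i, 'a) net \<Rightarrow> 'a \<Rightarrow> bool)"
proof (rule strongly_first_countable_convI[of _ uru_filter])
  show "filter_conv (uru :: ('i, 'a) net \<Rightarrow> 'a \<Rightarrow> bool) F x \<longleftrightarrow> F \<noteq> bot \<and> uru_filter F x" for F x
    using assms(1) uru_iff_tail_filter by (rule filter_conv_iff)
  fix x :: 'a
  let ?B = "\<lambda>y. sublevel (\<lambda>z. inf y \<bar>x - z\<bar>)"
  let ?T = "(\<lambda>(y, d, n). ?B y d n) ` (D \<times> D \<times> UNIV)"
  have main: "\<exists>\<S>\<subseteq>?T. (\<forall>A\<in>\<S>. eventually (\<lambda>z. z \<in> A) F) \<and>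
      (\<forall>G. (\<forall>A\<in>\<S>. eventually (\<lambda>z. z \<in> A) G) \<longrightarrow> uru_filter G x)" if F: "uru_filter F x" for F
  proof -
    have "\<exists>d\<in>D. \<forall>n. eventually (\<lambda>z. z \<in> ?B y d n) F" if "y \<in> D" for y
    proof -
      have "0 \<le> y" using that D(2) by auto
      then have "ru_null (\<lambda>z. inf y \<bar>x - z\<bar>) F"
        using F unfolding uru_filter_def by blast
      then show ?thesis by (rule ru_null_cofinal[OF D(3)])
    qed
    \<comment> \<open>Choice of one regulator \<open>d y\<close> for each truncating element
      \<open>y\<close> of \<open>D\<close>.\<close>
    then obtain d where d: "\<And>y. y \<in> D \<Longrightarrow> d y \<in> D"
      "\<And>y n. y \<in> D \<Longrightarrow> eventually (\<lambda>z. z \<in> ?B y (d y) n) F"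
      by metis
    let ?S = "(\<lambda>(y, n). ?B y (d y) n) ` (D \<times> UNIV)"
    have "uru_filter G x" if G: "\<forall>A\<in>?S. eventually (\<lambda>z. z \<in> A) G" for G
      unfolding uru_filter_def
    proof (intro allI impI)
      fix y :: 'a
      obtain y' where y': "y' \<in> D" "y \<le> y'" using D(3) by blast
      have "?B y' (d y') n \<in> ?S" for n using y'(1) by force
      then have "eventually (\<lambda>z. z \<in> ?B y' (d y') n) G" for n by (rule bspec[OF G])
      moreover have "0 \<le> d y'" using d(1)[OF y'(1)] D(2) by auto
      ultimately have "ru_null (\<lambda>z. inf y' \<bar>x - z\<bar>) G"
        unfolding ru_null_iff by blast
      then show "ru_null (\<lambda>z. inf y \<bar>x - z\<bar>) G"
        by (rule ru_null_mono) (rule inf_mono[OF y'(2) order_refl])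
    qed
    moreover have "?S \<subseteq> ?T" using d(1) by force
    moreover have "\<forall>A\<in>?S. eventually (\<lambda>z. z \<in> A) F" using d(2) by auto
    ultimately show ?thesis by blast
  qed
  show "\<exists>\<T>. countable \<T> \<and> (\<forall>A\<in>\<T>. x \<in> A) \<and>
      (\<forall>F. uru_filter F x \<longrightarrow> (\<exists>\<S>\<subseteq>\<T>. (\<forall>A\<in>\<S>. eventually (\<lambda>z. z \<in> A) F) \<and>
        (\<forall>G. (\<forall>A\<in>\<S>. eventually (\<lambda>z. z \<in> A) G) \<longrightarrow> uru_filter G x)))"
  proof (rule exI[of _ ?T], intro conjI allI impI)
    show "countable ?T" using D(1) by simp
    show "\<forall>A\<in>?T. x \<in> A" using D(2) by (auto intro!: mem_sublevel_zero inf_absorb2)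
  qed (rule main)
qed (rule convergence_structure_uru)

section \<open>A countable generating set from strong first countability\<close>

lemma strongly_first_countable_ru_imp_countable_generated:
  assumes "\<exists>f :: 'a::vector_lattice \<times> 'a set \<Rightarrow> 'i. inj f"
    and "strongly_first_countable_conv (ru :: ('i, 'a) net \<Rightarrow> 'a \<Rightarrow> bool)"
  shows "\<exists>C::'a set. countable C \<and> C \<subseteq> {0..} \<and> ideal_generated C = UNIV"
proof -
  have conv: "filter_conv (ru :: ('i, 'a) net \<Rightarrow> 'a \<Rightarrow> bool) F x \<longleftrightarrow> F \<noteq> bot \<and> ru_filter F x" for F x
    using assms(1) ru_iff_tail_filter by (rule filter_conv_iff)
  from assms(2)[unfolded strongly_first_countable_conv_def conv, THEN conjunct2, THEN spec[of _ 0]]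
  obtain \<H> :: "'a set set" where \<H>: "countable \<H>"
    "\<forall>F. F \<noteq> bot \<and> ru_filter F 0 \<longrightarrow>
      (\<exists>\<B>. filter_base \<B> \<and> \<B> \<subseteq> {A. eventually (\<lambda>y. y \<in> A) F} \<inter> \<H> \<and>
        filter_generated \<B> \<noteq> bot \<and> ru_filter (filter_generated \<B>) 0)"
    by (elim exE conjE)
  define bd where "bd A w \<longleftrightarrow> 0 \<le> w \<and> (\<forall>z\<in>A. \<bar>z\<bar> \<le> w)" for A and w :: 'a
  \<comment> \<open>The chosen value is meaningful only for order bounded \<open>A\<close>, hence
    the restriction in the definition of \<open>C\<close>.\<close>
  define b where "b A = (SOME w. bd A w)" for A
  define C where "C = b ` {A \<in> \<H>. \<exists>w. bd A w}"
  have b: "bd A (b A)" if "\<exists>w. bd A w" for A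
    unfolding b_def using that by (rule someI_ex)
  have "countable C" unfolding C_def using \<H>(1) by simp
  moreover have "C \<subseteq> {0..}" using b by (auto simp: C_def bd_def)
  \<comment> \<open>With \<open>v\<close> and \<open>I\<close> arbitrary, every ideal containing
    \<open>C\<close> is the whole space, and so is their intersection.\<close>
  moreover have "v \<in> I" if I: "vl_ideal I" "C \<subseteq> I" for v I
  proof -
    let ?B = "sublevel (\<lambda>z. \<bar>0 - z\<bar>) \<bar>v\<bar>"
    let ?F = "filter_generated (finite_inters (range ?B))"
    have base: "filter_base (finite_inters (range ?B))"
      by (rule filter_base_finite_inters[of _ 0]) (auto intro!: mem_sublevel_zero)
    have "ru_filter ?F 0"
      unfolding ru_filter_def ru_null_iff
      using eventually_filter_generated_mem[OF base] subset_finite_inters[of "range ?B"]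
      by (intro exI[of _ "\<bar>v\<bar>"]) auto
    from \<H>(2)[rule_format, OF conjI[OF filter_generated_neq_bot[OF base] this]]
    obtain \<B> where \<B>: "filter_base \<B>" "\<B> \<subseteq> \<H>" "\<And>A. A \<in> \<B> \<Longrightarrow> eventually (\<lambda>y. y \<in> A) ?F"
      "ru_filter (filter_generated \<B>) 0"
      by blast
    obtain w where w: "0 \<le> w" "\<forall>\<epsilon>>0. eventually (\<lambda>z. \<bar>0 - z\<bar> \<le> \<epsilon> *\<^sub>R w) (filter_generated \<B>)"
      using \<B>(4) unfolding ru_filter_def ru_null_def by blast
    \<comment> \<open>The single value \<epsilon> = 1 already yields an order bounded member of
      \<B>.\<close>
    have "eventually (\<lambda>z. \<bar>0 - z\<bar> \<le> 1 *\<^sub>R w) (filter_generated \<B>)"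
      using w(2)[rule_format, OF zero_less_one] .
    then obtain A where A: "A \<in> \<B>" "\<And>z. z \<in> A \<Longrightarrow> \<bar>z\<bar> \<le> w"
      unfolding eventually_filter_generated[OF \<B>(1)] by auto
    then have "bd A w" using w(1) by (simp add: bd_def)
    then have "bd A (b A)" using b by blast
    moreover have "b A \<in> I"
      using \<open>bd A w\<close> A(1) \<B>(2) I(2) unfolding C_def by blast
    \<comment> \<open>\<open>A\<close> contains a finite intersection of the sets
      \<open>?B k\<close>. They decrease in k, so a multiple of |v| small enough for an upper bound
      of the indices lies in all of them.\<close>
    moreover have "\<exists>n. inverse (real (Suc n)) *\<^sub>R \<bar>v\<bar> \<in> A"
    proof -
      obtain E where E: "E \<in> finite_inters (range ?B)" and EA: "\<forall>y\<in>E. y \<in> A"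
        using \<B>(3)[OF A(1)] unfolding eventually_filter_generated[OF base] by (elim bexE)
      obtain \<F> where \<F>: "finite \<F>" "\<F> \<subseteq> range ?B" and "E = \<Inter>\<F>"
        using E unfolding finite_inters_def by (elim imageE CollectE conjE)
      obtain K where K: "finite K" "\<F> = ?B ` K"
        using finite_subset_image[OF \<F>] by (elim exE conjE)
      obtain n where n: "\<forall>k\<in>K. k \<le> n"
        using K(1) unfolding finite_nat_set_iff_bounded_le by (elim exE)
      have "inverse (real (Suc n)) *\<^sub>R \<bar>v\<bar> \<in> ?B k" if "k \<in> K" for k
      proof -
        have "inverse (real (Suc n)) *\<^sub>R \<bar>v\<bar> \<le> inverse (real (Suc k)) *\<^sub>R \<bar>v\<bar>"
          using bspec[OF n that] by (intro scaleR_right_mono le_imp_inverse_le) simp_all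
        moreover have "\<bar>0 - inverse (real (Suc n)) *\<^sub>R \<bar>v\<bar>\<bar> = inverse (real (Suc n)) *\<^sub>R \<bar>v\<bar>"
          unfolding diff_0 abs_minus_cancel by (intro abs_of_nonneg scaleR_nonneg_nonneg) simp_all
        ultimately show ?thesis unfolding sublevel_def by (simp only: mem_Collect_eq)
      qed
      then have "inverse (real (Suc n)) *\<^sub>R \<bar>v\<bar> \<in> E"
        unfolding \<open>E = \<Inter>\<F>\<close> K(2) by (rule INT_I)
      then show ?thesis using bspec[OF EA] by (intro exI)
    qed
    ultimately obtain n where n: "\<bar>inverse (real (Suc n)) *\<^sub>R \<bar>v\<bar>\<bar> \<le> b A" and bI: "b A \<in> I"
      unfolding bd_def by blast
    have "inverse (real (Suc n)) *\<^sub>R \<bar>v\<bar> \<le> b A"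
      by (rule order_trans[OF abs_ge_self n])
    \<comment> \<open>Scaling back gives a multiple of \<open>b A\<close> above |v|, and solidity of
      \<open>I\<close> applies.\<close>
    then have "real (Suc n) *\<^sub>R (inverse (real (Suc n)) *\<^sub>R \<bar>v\<bar>) \<le> real (Suc n) *\<^sub>R b A"
      by (rule scaleR_left_mono) simp
    then have "\<bar>v\<bar> \<le> \<bar>real (Suc n) *\<^sub>R b A\<bar>"
      using order_trans[OF _ abs_ge_self] by simp
    moreover have "real (Suc n) *\<^sub>R b A \<in> I"
      using I(1) bI unfolding vl_ideal_def by (blast intro: subspace_scale)
    ultimately show ?thesis
      using I(1) unfolding vl_ideal_def solid_def by blast
  qed
  then have "ideal_generated C = UNIV"
    unfolding ideal_generated_def hull_def by blast
  ultimately show ?thesis by blast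
qed

theorem proposition4p1:
  assumes index_type_large: "\<exists>f :: 'a::archimedean_vector_lattice \<times> 'a set \<Rightarrow> 'i. inj f"
  shows "first_countable_conv (ru :: ('i, 'a) net \<Rightarrow> 'a \<Rightarrow> bool) \<and>
    ((\<exists>C::'a set. countable C \<and> C \<subseteq> {0..} \<and> ideal_generated C = UNIV) \<longleftrightarrow>
      strongly_first_countable_conv (ru :: ('i, 'a) net \<Rightarrow> 'a \<Rightarrow> bool)) \<and>
    ((\<exists>C::'a set. countable C \<and> C \<subseteq> {0..} \<and> ideal_generated C = UNIV) \<or>
      strongly_first_countable_conv (ru :: ('i, 'a) net \<Rightarrow> 'a \<Rightarrow> bool) \<longrightarrow>
      strongly_first_countable_conv (uru :: ('i, 'a) net \<Rightarrow> 'a \<Rightarrow> bool))"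
proof -
  have "strongly_first_countable_conv (ru :: ('i, 'a) net \<Rightarrow> 'a \<Rightarrow> bool) \<and>
      strongly_first_countable_conv (uru :: ('i, 'a) net \<Rightarrow> 'a \<Rightarrow> bool)"
    if C: "\<exists>C::'a set. countable C \<and> C \<subseteq> {0..} \<and> ideal_generated C = UNIV"
  proof -
    obtain D :: "'a set" where "countable D" "D \<subseteq> {0..}" "\<And>v. \<exists>d\<in>D. v \<le> d"
      using C countable_generated_imp_cofinal by blast
    then show ?thesis
      using strongly_first_countable_ru[OF index_type_large]
        strongly_first_countable_uru[OF index_type_large] by blast
  qed
  \<comment> \<open>For \<open>uru\<close>, (ii) is first converted to (i) by the preceding
    lemma.\<close>
  then show ?thesis
    using first_countable_ru[OF index_type_large]
      strongly_first_countable_ru_imp_countable_generated[OF index_type_large] by blast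
qed

end
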